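(* In the setting described in the context, let $\gamma\in(0,2\theta)$ and fix any $\delta\in(0,1)$. Set $\nu_K=\frac{2\eta_K}{\theta}+\frac{\varsigma}{N}$ and $$\varphi(N,K,\delta)=\frac{2\eta_K}{\theta}+\nu_K\sqrt{2N\log\frac{2}{\delta}}.$$ Then, with probability at least $1-\delta$ over the random draw $\mathcal D\sim\mathbb P^N$, $$\|\Delta_{\mathcal D}(\hat x_K)\|\le \varphi(N,K,\delta),$$ and consequently (on the same event) the true Davis–Yin fixed-point residual satisfies $$\rho_{\mathrm{DY}}(\hat z_K)\le \hat\rho_{\mathcal D}(\hat z_K)+\gamma\,\varphi(N,K,\delta).$$
   Context: Let $n,d,N\in\mathbb N$ with $N\ge1$, $K\in\mathbb N$, $\gamma>0$, $\theta>0$, $\varsigma>0$; $\mathbb R^n$ carries the Euclidean inner product and norm. $A,B:\mathbb R^n\rightrightarrows\mathbb R^n$ are maximally monotone set-valued operators and $C:\mathbb R^n\to\mathbb R^n$ is $\theta$-cocoercive, where a map $F:\mathbb R^n\to\mathbb R^n$ is $\theta$-cocoercive if $\langle x-y,F(x)-F(y)\rangle\ge\theta\|F(x)-F(y)\|^2$ for all $x,y$. It is assumed that $\operatorname{zer}(A+B+C)=\{x:0\in A(x)+B(x)+C(x)\}\neq\emptyset$. The resolvent of a maximally monotone $A$ is $J_{\gamma A}=(\mathrm{Id}+\gamma A)^{-1}$ (single-valued, defined on all of $\mathbb R^n$). Oracle: $\Xi\subseteq\mathbb R^d$ is a sample space with a probability distribution $\mathbb P$, and $O:\mathbb R^n\times\Xi\to\mathbb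 R^n$ (measurable in $\xi$) satisfies: (i) $\mathbb E_{\xi\sim\mathbb P}[O(x,\xi)]=C(x)$ for all $x$; (ii) $\|O(x,\xi)-O(x,\xi')\|\le\varsigma$ for all $x\in\mathbb R^n$, $\xi,\xi'\in\Xi$; (iii) $O(\cdot,\xi)$ is $\theta$-cocoercive for every $\xi\in\Xi$. A dataset is $\mathcal D=(\xi^1,\dots,\xi^N)\in\Xi^N$; $\mathcal D\sim\mathbb P^N$ means the samples are i.i.d. from $\mathbb P$. Put $\widehat C_{\mathcal D}(x)=\frac1N\sum_{i=1}^N O(x,\xi^i)$. From a fixed (deterministic, dataset-independent) initial point $\hat z_0\in\mathbb R^n$, the data-driven Davis–Yin iteration is $\hat x_t=J_{\gamma B}(\hat z_t)$, $\hat y_t=J_{\gamma A}(2\hat x_t-\hat z_t-\gamma\widehat C_{\mathcal D}(\hat x_t))$, $\hat z_{t+1}=\hat z_t+\hat y_t-\hat x_t$. Define $T_{\mathrm{DY}}(z)=z-J_{\gamma B}(z)+J_{\gamma A}\big(2J_{\gamma B}(z)-z-\gamma C(J_{\gamma B}(z))\big)$, and $\widehat T_{\mathcal D}$ by the same formula with $\widehat C_{\mathcal D}$ in place of $C$ (so $\hat z_{t+1}=\widehat T_{\mathcal D}(\hat z_t)$). Residuals: $\rho_{\mathrm{DY}}(z)=\|z-T_{\mathrm{DY}}(z)\|$, $\hat\rho_{\mathcal D}(z)=\|z-\widehat T_{\mathcal D}(z)\|$. Sample-average error: $\Delta_{\mathcal D}(x)=\widehat C_{\mathcal D}(x)-C(x)$.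 For $i\in\{1,\dots,N\}$, $\mathcal D^i$ denotes a dataset obtained from $\mathcal D$ by replacing its $i$-th sample with an arbitrary $\tilde\xi^i\in\Xi$, and $\hat x_K^i$ is the corresponding iterate for $\mathcal D^i$ from the same initial point $\hat z_0$. The replace-one sensitivity is $\eta_K=\max_{i}\sup_{\mathcal D,\mathcal D^i}\|\hat x_K-\hat x_K^i\|$. *)

theory Defs
  imports "HOL-Probability.Probability"
begin

type_synonym 'a operator = "'a \<Rightarrow> 'a set"

definition monotone_operator :: "'a::real_inner operator \<Rightarrow> bool" where
  "monotone_operator A \<longleftrightarrow>
     (\<forall>x y. \<forall>u\<in>A x. \<forall>v\<in>A y. 0 \<le> (x - y) \<bullet> (u - v))"

definition maximally_monotone :: "'a::real_inner operator \<Rightarrow> bool" where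
  "maximally_monotone A \<longleftrightarrow> monotone_operator A \<and>
     (\<forall>A'. monotone_operator A' \<and> (\<forall>x. A x \<subseteq> A' x) \<longrightarrow> A' = A)"

definition cocoercive :: "real \<Rightarrow> ('a::real_inner \<Rightarrow> 'a) \<Rightarrow> bool" where
  "cocoercive \<theta> F \<longleftrightarrow>
     (\<forall>x y. (x - y) \<bullet> (F x - F y) \<ge> \<theta> * (norm (F x - F y))\<^sup>2)"

definition zer3 :: "'a::real_inner operator \<Rightarrow> 'a operator \<Rightarrow> ('a \<Rightarrow> 'a) \<Rightarrow> 'a set" where
  "zer3 A B C = {x. \<exists>a\<in>A x. \<exists>b\<in>B x. 0 = a + b + C x}"

(* The value at z of (Id + \<gamma> A)^(-1). It is only meaningful where that inverse
   is single-valued; for \<gamma> > 0 and A maximally monotone on a Euclidean space this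
   is everywhere (Minty). *)
definition resolvent :: "real \<Rightarrow> 'a::real_inner operator \<Rightarrow> 'a \<Rightarrow> 'a" where
  "resolvent \<gamma> A z = (THE x. \<exists>u\<in>A x. z = x + \<gamma> *\<^sub>R u)"

(* F is the forward (single-valued) operator: the true C or its sample average. *)
definition dy_operator ::
  "real \<Rightarrow> 'a::real_inner operator \<Rightarrow> 'a operator \<Rightarrow> ('a \<Rightarrow> 'a) \<Rightarrow> 'a \<Rightarrow> 'a" where
  "dy_operator \<gamma> A B F z = z - resolvent \<gamma> B z
     + resolvent \<gamma> A (2 *\<^sub>R resolvent \<gamma> B z - z - \<gamma> *\<^sub>R F (resolvent \<gamma> B z))"

definition dy_residual ::
  "real \<Rightarrow> 'a::real_inner operator \<Rightarrow> 'a operator \<Rightarrow> ('a \<Rightarrow> 'a) \<Rightarrow> 'a \<Rightarrow> real" where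
  "dy_residual \<gamma> A B F z = norm (z - dy_operator \<gamma> A B F z)"

primrec dy_z ::
  "real \<Rightarrow> 'a::real_inner operator \<Rightarrow> 'a operator \<Rightarrow> ('a \<Rightarrow> 'a) \<Rightarrow> 'a \<Rightarrow> nat \<Rightarrow> 'a" where
  "dy_z \<gamma> A B F z0 0 = z0"
| "dy_z \<gamma> A B F z0 (Suc t) =
     (let z = dy_z \<gamma> A B F z0 t;
          x = resolvent \<gamma> B z;
          y = resolvent \<gamma> A (2 *\<^sub>R x - z - \<gamma> *\<^sub>R F x)
      in z + y - x)"

definition dy_x ::
  "real \<Rightarrow> 'a::real_inner operator \<Rightarrow> 'a operator \<Rightarrow> ('a \<Rightarrow> 'a) \<Rightarrow> 'a \<Rightarrow> nat \<Rightarrow> 'a" where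
  "dy_x \<gamma> A B F z0 t = resolvent \<gamma> B (dy_z \<gamma> A B F z0 t)"

lemma dy_z_Suc: "dy_z \<gamma> A B F z0 (Suc t) = dy_operator \<gamma> A B F (dy_z \<gamma> A B F z0 t)"
  by (simp add: dy_operator_def Let_def)

(* A dataset of size N is a function D on {1..N}; G x \<xi> is the oracle. *)
definition empirical_map ::
  "('a::real_inner \<Rightarrow> 'b \<Rightarrow> 'a) \<Rightarrow> nat \<Rightarrow> (nat \<Rightarrow> 'b) \<Rightarrow> 'a \<Rightarrow> 'a" where
  "empirical_map G N D x = (1 / real N) *\<^sub>R (\<Sum>i=1..N. G x (D i))"

definition sample_error ::
  "('a::real_inner \<Rightarrow> 'b \<Rightarrow> 'a) \<Rightarrow> ('a \<Rightarrow> 'a) \<Rightarrow> nat \<Rightarrow> (nat \<Rightarrow> 'b) \<Rightarrow> 'a \<Rightarrow> 'a" where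
  "sample_error G C N D x = empirical_map G N D x - C x"

(* The supremum is taken in the reals. It is a true supremum: if 0 < \<gamma> < 2 \<theta>, A and B
   are maximally monotone, each G _ \<xi> is \<theta>-cocoercive and G x _ has oscillation at most
   \<sigma> on \<Xi>, the Davis-Yin operators are nonexpansive and the norms below are bounded
   by K \<gamma> \<sigma> / N. *)
definition replace_one_sensitivity ::
  "real \<Rightarrow> 'a::real_inner operator \<Rightarrow> 'a operator \<Rightarrow> ('a \<Rightarrow> 'b \<Rightarrow> 'a) \<Rightarrow> 'b set
     \<Rightarrow> nat \<Rightarrow> 'a \<Rightarrow> nat \<Rightarrow> real" where
  "replace_one_sensitivity \<gamma> A B G \<Xi> N z0 K =
     (MAX i\<in>{1..N}. SUP (D, \<xi>) \<in> (PiE {1..N} (\<lambda>_. \<Xi>)) \<times> \<Xi>.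
        norm (dy_x \<gamma> A B (empirical_map G N D) z0 K
            - dy_x \<gamma> A B (empirical_map G N (D(i := \<xi>))) z0 K))"

definition nu_bound :: "real \<Rightarrow> real \<Rightarrow> real \<Rightarrow> nat \<Rightarrow> real" where
  "nu_bound \<eta> \<theta> \<sigma> N = 2 * \<eta> / \<theta> + \<sigma> / real N"

definition phi_bound :: "real \<Rightarrow> real \<Rightarrow> real \<Rightarrow> nat \<Rightarrow> real \<Rightarrow> real" where
  "phi_bound \<eta> \<theta> \<sigma> N \<delta> =
     2 * \<eta> / \<theta> + nu_bound \<eta> \<theta> \<sigma> N * sqrt (2 * real N * ln (2 / \<delta>))"

end

theory Submission imports Defs begin

text \<open>
  A sample enters the error \<open>\<Delta>\<close> at the last iterate directly, with weight \<open>1 / N\<close>, and through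
  the iterate, which moves by at most \<open>\<eta>\<close>. As the oracle and \<open>C\<close> are \<open>1 / \<theta>\<close>-Lipschitz, replacing one
  sample changes \<open>\<Delta>\<close> by at most \<open>\<nu> = 2 \<eta> / \<theta> + \<sigma> / N\<close>, and \<open>norm (E \<Delta>) \<le> 2 \<eta> / \<theta>\<close>. McDiarmid's
  inequality for \<open>norm \<Delta>\<close>, combined with a variance bound for its mean, gives the tail estimate; the
  residual bound follows from nonexpansiveness of the resolvent. Its being defined everywhere is
  Minty's theorem, proved here through the finite intersection property of balls.\<close>

subsection \<open>Concentration on product spaces\<close>

text \<open>At a fixed \<open>x\<close> the terms \<open>G x (D i) - C x\<close> are independent and
  centred. At the iterate they are neither, since it depends on every sample. Bounded differences
  only ask the samples themselves to be independent, and so survive this coupling. The radius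
  \<open>\<nu> * sqrt (2 * N * ln (2 / \<delta>))\<close> is what a tail
  \<open>2 * exp (- t^2 / (2 * N * \<nu>^2))\<close> would give. The scalar exponent
  \<open>- 2 * t^2 / (N * \<nu>^2)\<close> is four times as large, and this slack pays for the mean
  of the norm exceeding the norm of the mean by up to \<open>\<nu> * sqrt N\<close>. Two obligations
  remain. The supremum in \<eta> is a real one and bounds its members only once the family is known
  to be bounded above; a crude estimate growing geometrically in \<open>K\<close> settles this. And
  the event must be measurable although the oracle is measurable only in the sample; its continuity
  in \<open>x\<close> closes that gap.\<close>

lemma fun_upd_in_space_PiM:
  assumes "x \<in> space (PiM I M)" "y \<in> space (M i)"
  shows "x(i := y) \<in> space (PiM (insert i I) M)"
  using assms by (auto simp: space_PiM PiE_iff extensional_def)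

lemma borel_measurable_marginal:
  fixes f :: "('i \<Rightarrow> 'a) \<Rightarrow> 'b::{banach, second_countable_topology}"
  assumes "sigma_finite_measure (M i)"
    and [measurable]: "f \<in> borel_measurable (PiM (insert i I) M)"
  shows "(\<lambda>x. \<integral>y. f (x(i := y)) \<partial>M i) \<in> borel_measurable (PiM I M)"
proof -
  interpret sigma_finite_measure "M i" by fact
  show ?thesis by measurable
qed

lemma integrable_prob_bounded:
  fixes f :: "'a \<Rightarrow> 'b::{banach, second_countable_topology}"
  assumes "prob_space M" "f \<in> borel_measurable M" "\<And>x. x \<in> space M \<Longrightarrow> norm (f x) \<le> b"
  shows "integrable M f"
proof -
  interpret prob_space M by fact
  show ?thesis
    by (rule integrable_const_bound[of _ b]) (use assms in auto)
qed

lemma norm_integral_prob_le: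
  fixes f :: "'a \<Rightarrow> 'b::{banach, second_countable_topology}"
  assumes M: "prob_space M" and f: "f \<in> borel_measurable M"
    and b: "\<And>x. x \<in> space M \<Longrightarrow> norm (f x) \<le> b"
  shows "norm (\<integral>x. f x \<partial>M) \<le> b"
proof -
  interpret prob_space M by fact
  have i: "integrable M f" using assms by (rule integrable_prob_bounded)
  have "norm (\<integral>x. f x \<partial>M) \<le> (\<integral>x. norm (f x) \<partial>M)" by (rule integral_norm_bound)
  also have "\<dots> \<le> (\<integral>x. b \<partial>M)" using i b by (intro integral_mono) auto
  finally show ?thesis by (simp add: prob_space)
qed

lemma norm_integral_diff_prob_le:
  fixes f :: "'a \<Rightarrow> 'b::{banach, second_countable_topology}"
  assumes M: "prob_space M" and "integrable M f" "integrable M g"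
    and "\<And>x. x \<in> space M \<Longrightarrow> norm (f x - g x) \<le> b"
  shows "norm ((\<integral>x. f x \<partial>M) - (\<integral>x. g x \<partial>M)) \<le> b"
  using norm_integral_prob_le[OF M, of "\<lambda>x. f x - g x" b] assms by simp

text \<open>The induction step of both concentration proofs: averaging out coordinate
  \<open>i\<close> does not spoil the differences in the other coordinates. As \<open>i\<close> and
  \<open>j\<close> differ, the two updates commute, and the bound \<open>c j\<close> holds pointwise
  under the integral.\<close>

lemma norm_marginal_diff_le:
  fixes f :: "('i \<Rightarrow> 'a) \<Rightarrow> 'b::{banach, second_countable_topology}"
  assumes M: "\<And>j. prob_space (M j)" and i: "i \<notin> I"
    and f[measurable]: "f \<in> borel_measurable (PiM (insert i I) M)"
    and b: "\<And>x. x \<in> space (PiM (insert i I) M) \<Longrightarrow> norm (f x) \<le> b"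
    and c: "\<And>j x y. j \<in> I \<Longrightarrow> x \<in> space (PiM (insert i I) M) \<Longrightarrow> y \<in> space (M j) \<Longrightarrow>
       norm (f x - f (x(j := y))) \<le> c j"
    and j: "j \<in> I" and x: "x \<in> space (PiM I M)" and y: "y \<in> space (M j)"
  shows "norm ((\<integral>z. f (x(i := z)) \<partial>M i) - (\<integral>z. f ((x(j := y))(i := z)) \<partial>M i)) \<le> c j"
proof (rule norm_integral_diff_prob_le[OF M])
  have xj: "x(j := y) \<in> space (PiM I M)"
    using fun_upd_in_space_PiM[of x I M y j] x y j by (simp add: insert_absorb)
  show "integrable (M i) (\<lambda>z. f (x(i := z)))"
    by (rule integrable_prob_bounded[OF M, where b = b])
       (use x i in \<open>auto intro!: b fun_upd_in_space_PiM
         measurable_compose[OF measurable_component_update[OF x i] f]\<close>)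
  show "integrable (M i) (\<lambda>z. f ((x(j := y))(i := z)))"
    by (rule integrable_prob_bounded[OF M, where b = b])
       (use xj i in \<open>auto intro!: b fun_upd_in_space_PiM
         measurable_compose[OF measurable_component_update[OF xj i] f]\<close>)
  fix z assume "z \<in> space (M i)"
  then have "x(i := z) \<in> space (PiM (insert i I) M)" using x by (rule fun_upd_in_space_PiM[rotated])
  moreover have "(x(j := y))(i := z) = (x(i := z))(j := y)" using i j by auto
  ultimately show "norm (f (x(i := z)) - f ((x(j := y))(i := z))) \<le> c j"
    using c[OF j _ y, of "x(i := z)"] by simp
qed

text \<open>Hoeffding's lemma takes an interval; an oscillation bound \<open>c\<close> supplies one
  of length \<open>c\<close> that starts at the infimum of \<open>f\<close>.\<close>

lemma Hoeffding_nn_integral_oscillation: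
  fixes f :: "'a \<Rightarrow> real"
  assumes M: "prob_space M" and f[measurable]: "f \<in> borel_measurable M"
    and c: "\<And>x y. x \<in> space M \<Longrightarrow> y \<in> space M \<Longrightarrow> \<bar>f x - f y\<bar> \<le> c" and s: "0 < s"
  shows "(\<integral>\<^sup>+x. ennreal (exp (s * (f x - (\<integral>y. f y \<partial>M)))) \<partial>M) \<le> ennreal (exp (s\<^sup>2 * c\<^sup>2 / 8))"
proof -
  interpret prob_space M by fact
  define a where "a = Inf (f ` space M)"
  obtain x0 where x0: "x0 \<in> space M" using not_empty by blast
  have "f x0 - c \<le> f x" if "x \<in> space M" for x using c[OF x0 that] by linarith
  then have bdd: "bdd_below (f ` space M)" by (intro bdd_belowI2)
  have "a \<le> f x \<and> f x \<le> a + c" if x: "x \<in> space M" for x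
  proof
    show "a \<le> f x" unfolding a_def by (rule cINF_lower[OF bdd x])
    have "f x - c \<le> a" unfolding a_def
      by (rule cINF_greatest) (use x0 c[OF x] in \<open>auto simp: abs_le_iff algebra_simps\<close>)
    then show "f x \<le> a + c" by simp
  qed
  then interpret interval_bounded_random_variable M f a "a + c"
    by unfold_locales auto
  show ?thesis using Hoeffdings_lemma_nn_integral[OF s] by simp
qed

text \<open>Tensorisation in place of a martingale. With \<open>g\<close> the average of
  \<open>f\<close> over coordinate \<open>i\<close>, \<open>f - E f\<close> is
  \<open>(f - g) + (g - E g)\<close>: Hoeffding's lemma bounds the exponential moment of the first
  part with the other coordinates frozen, and the induction hypothesis bounds that of the second.
  With nonnegative integrals, Fubini needs measurability only.\<close>

lemma McDiarmid_nn_integral: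
  fixes f :: "('i \<Rightarrow> 'a) \<Rightarrow> real"
  assumes M: "\<And>j. prob_space (M j)" and I: "finite I" and s: "0 < s"
    and f: "f \<in> borel_measurable (PiM I M)"
    and b: "\<And>x. x \<in> space (PiM I M) \<Longrightarrow> norm (f x) \<le> b"
    and c: "\<And>j x y. j \<in> I \<Longrightarrow> x \<in> space (PiM I M) \<Longrightarrow> y \<in> space (M j) \<Longrightarrow>
       norm (f x - f (x(j := y))) \<le> c j"
  shows "(\<integral>\<^sup>+x. ennreal (exp (s * (f x - (\<integral>y. f y \<partial>PiM I M)))) \<partial>PiM I M)
    \<le> ennreal (exp (s\<^sup>2 * (\<Sum>j\<in>I. (c j)\<^sup>2) / 8))"
  using I f b c
proof (induction I arbitrary: f rule: finite_induct)
  case empty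
  \<comment> \<open>The empty product is a one-point space, where \<open>f\<close> equals its
    mean.\<close>
  show ?case
    by (simp add: PiM_empty lebesgue_integral_count_space_finite nn_integral_count_space_finite)
next
  case (insert i I)
  interpret product_sigma_finite M
    by (intro product_sigma_finite.intro prob_space_imp_sigma_finite M)
  note [measurable] = insert.prems(1)
  define g where "g x = (\<integral>y. f (x(i := y)) \<partial>M i)" for x
  have g[measurable]: "g \<in> borel_measurable (PiM I M)"
    unfolding g_def by (rule borel_measurable_marginal) (simp_all add: M prob_space_imp_sigma_finite)
  have sec: "(\<lambda>y. f (x(i := y))) \<in> borel_measurable (M i)" if "x \<in> space (PiM I M)" for x
    by (rule measurable_compose[OF measurable_component_update[OF that insert.hyps(2)] insert.prems(1)])
  have secb: "norm (f (x(i := y))) \<le> b" if "x \<in> space (PiM I M)" "y \<in> space (M i)" for x y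
    by (intro insert.prems(2) fun_upd_in_space_PiM that)
  have gb: "norm (g x) \<le> b" if "x \<in> space (PiM I M)" for x
    unfolding g_def by (rule norm_integral_prob_le[OF M sec[OF that] secb[OF that]])
  have gc: "norm (g x - g (x(j := y))) \<le> c j"
    if "j \<in> I" "x \<in> space (PiM I M)" "y \<in> space (M j)" for j x y
    unfolding g_def
    by (rule norm_marginal_diff_le[OF M insert.hyps(2) insert.prems(1,2)])
       (assumption, rule insert.prems(3), use that in auto)
  have E: "(\<integral>y. f y \<partial>PiM (insert i I) M) = (\<integral>x. g x \<partial>PiM I M)"
    unfolding g_def
    by (rule product_integral_insert[OF insert.hyps])
       (rule integrable_prob_bounded[OF prob_space_PiM[OF M] insert.prems(1,2)])
  define e where "e = (\<integral>x. g x \<partial>PiM I M)"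
  have inner: "(\<integral>\<^sup>+y. ennreal (exp (s * (f (x(i := y)) - e))) \<partial>M i)
      \<le> ennreal (exp (s * (g x - e))) * ennreal (exp (s\<^sup>2 * (c i)\<^sup>2 / 8))"
    if x: "x \<in> space (PiM I M)" for x
  proof -
    have [measurable]: "(\<lambda>y. f (x(i := y))) \<in> borel_measurable (M i)" by (rule sec[OF x])
    have "(\<integral>\<^sup>+y. ennreal (exp (s * (f (x(i := y)) - e))) \<partial>M i)
      = (\<integral>\<^sup>+y. ennreal (exp (s * (g x - e))) * ennreal (exp (s * (f (x(i := y)) - g x))) \<partial>M i)"
      by (intro nn_integral_cong)
         (simp add: ennreal_mult[symmetric] exp_add[symmetric] algebra_simps)
    also have "\<dots> = ennreal (exp (s * (g x - e))) * (\<integral>\<^sup>+y. ennreal (exp (s * (f (x(i := y)) - g x))) \<partial>M i)"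
      by (rule nn_integral_cmult) measurable
    also have "\<dots> \<le> ennreal (exp (s * (g x - e))) * ennreal (exp (s\<^sup>2 * (c i)\<^sup>2 / 8))"
      unfolding g_def
    proof (intro mult_left_mono Hoeffding_nn_integral_oscillation M s sec x)
      fix y z assume "y \<in> space (M i)" "z \<in> space (M i)"
      then show "\<bar>f (x(i := y)) - f (x(i := z))\<bar> \<le> c i"
        using insert.prems(3)[of i "x(i := y)" z] fun_upd_in_space_PiM[of x I M y i] x
        by (simp del: fun_upd_apply)
    qed simp
    finally show ?thesis .
  qed
  have "(\<integral>\<^sup>+x. ennreal (exp (s * (f x - (\<integral>y. f y \<partial>PiM (insert i I) M)))) \<partial>PiM (insert i I) M)
     = (\<integral>\<^sup>+x. \<integral>\<^sup>+y. ennreal (exp (s * (f (x(i := y)) - e))) \<partial>M i \<partial>PiM I M)"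
    unfolding E e_def by (rule product_nn_integral_insert[OF insert.hyps]) measurable
  also have "\<dots> \<le> (\<integral>\<^sup>+x. ennreal (exp (s * (g x - e))) * ennreal (exp (s\<^sup>2 * (c i)\<^sup>2 / 8)) \<partial>PiM I M)"
    by (intro nn_integral_mono inner)
  also have "\<dots> = (\<integral>\<^sup>+x. ennreal (exp (s * (g x - e))) \<partial>PiM I M) * ennreal (exp (s\<^sup>2 * (c i)\<^sup>2 / 8))"
    by (rule nn_integral_multc) measurable
  also have "\<dots> \<le> ennreal (exp (s\<^sup>2 * (\<Sum>j\<in>I. (c j)\<^sup>2) / 8)) * ennreal (exp (s\<^sup>2 * (c i)\<^sup>2 / 8))"
    unfolding e_def by (intro mult_right_mono insert.IH g gb gc) auto
  also have "\<dots> = ennreal (exp (s\<^sup>2 * (\<Sum>j\<in>insert i I. (c j)\<^sup>2) / 8))"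
    using insert.hyps by (simp add: ennreal_mult[symmetric] exp_add[symmetric] field_simps)
  finally show ?case .
qed

text \<open>Chernoff's method: the indicator of the event is dominated by a multiple of the
  exponential moment bounded above.\<close>

theorem McDiarmid_ineq_gt:
  fixes f :: "('i \<Rightarrow> 'a) \<Rightarrow> real"
  assumes M: "\<And>j. prob_space (M j)" and I: "finite I"
    and f[measurable]: "f \<in> borel_measurable (PiM I M)"
    and b: "\<And>x. x \<in> space (PiM I M) \<Longrightarrow> norm (f x) \<le> b"
    and c: "\<And>j x y. j \<in> I \<Longrightarrow> x \<in> space (PiM I M) \<Longrightarrow> y \<in> space (M j) \<Longrightarrow>
       norm (f x - f (x(j := y))) \<le> c j"
    and pos: "0 < (\<Sum>j\<in>I. (c j)\<^sup>2)" and t: "0 < t"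
  shows "measure (PiM I M) {x\<in>space (PiM I M). (\<integral>y. f y \<partial>PiM I M) + t < f x}
    \<le> exp (- 2 * t\<^sup>2 / (\<Sum>j\<in>I. (c j)\<^sup>2))"
proof -
  define V where "V = (\<Sum>j\<in>I. (c j)\<^sup>2)"
  \<comment> \<open>The minimiser of \<open>- s * t + s^2 * V / 8\<close>; the minimum is
    \<open>- 2 * t^2 / V\<close>.\<close>
  define s where "s = 4 * t / V"
  define e where "e = (\<integral>y. f y \<partial>PiM I M)"
  have V: "0 < V" using pos by (simp add: V_def)
  then have s: "0 < s" using t by (simp add: s_def)
  interpret P: prob_space "PiM I M" by (rule prob_space_PiM[OF M])
  have "emeasure (PiM I M) {x\<in>space (PiM I M). e + t < f x}
      = (\<integral>\<^sup>+x. indicator {x\<in>space (PiM I M). e + t < f x} x \<partial>PiM I M)" by simp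
  also have "\<dots> \<le> (\<integral>\<^sup>+x. ennreal (exp (- s * t)) * ennreal (exp (s * (f x - e))) \<partial>PiM I M)"
  proof (intro nn_integral_mono)
    fix x
    show "indicator {x\<in>space (PiM I M). e + t < f x} x
        \<le> ennreal (exp (- s * t)) * ennreal (exp (s * (f x - e)))"
    proof (cases "e + t < f x")
      case True
      then have "0 \<le> s * (f x - e - t)" using s by simp
      then have "1 \<le> exp (s * (f x - e - t))" by simp
      also have "\<dots> = exp (- s * t) * exp (s * (f x - e))"
        by (simp add: exp_add[symmetric] algebra_simps)
      finally have "ennreal 1 \<le> ennreal (exp (- s * t) * exp (s * (f x - e)))" by (rule ennreal_leI)
      then show ?thesis by (simp add: ennreal_mult indicator_def)
    qed simp
  qed
  also have "\<dots> = ennreal (exp (- s * t)) * (\<integral>\<^sup>+x. ennreal (exp (s * (f x - e))) \<partial>PiM I M)"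
    by (rule nn_integral_cmult) measurable
  also have "\<dots> \<le> ennreal (exp (- s * t)) * ennreal (exp (s\<^sup>2 * V / 8))"
  proof (rule mult_left_mono)
    show "(\<integral>\<^sup>+x. ennreal (exp (s * (f x - e))) \<partial>PiM I M) \<le> ennreal (exp (s\<^sup>2 * V / 8))"
      unfolding e_def V_def by (rule McDiarmid_nn_integral[OF M I s f b c])
  qed simp
  also have "\<dots> = ennreal (exp (- 2 * t\<^sup>2 / V))"
    using V by (simp add: ennreal_mult[symmetric] exp_add[symmetric] s_def field_simps power2_eq_square)
  finally show ?thesis
    by (simp add: P.emeasure_eq_measure V_def e_def)
qed

text \<open>A variance bound of Efron-Stein type. The conditional mean \<open>g\<close> is
  orthogonal to \<open>f - g\<close>, so the second moment splits by Pythagoras; the part of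
  \<open>f - g\<close> costs at most \<open>(c i)^2\<close>, and the induction continues with
  \<open>g\<close>. The inner product of the target space is essential here: for the vector itself
  no exponential moment is available.\<close>

lemma second_moment_le_bounded_differences:
  fixes f :: "('i \<Rightarrow> 'a) \<Rightarrow> 'b::euclidean_space"
  assumes M: "\<And>j. prob_space (M j)" and I: "finite I"
    and f: "f \<in> borel_measurable (PiM I M)"
    and b: "\<And>x. x \<in> space (PiM I M) \<Longrightarrow> norm (f x) \<le> b"
    and c: "\<And>j x y. j \<in> I \<Longrightarrow> x \<in> space (PiM I M) \<Longrightarrow> y \<in> space (M j) \<Longrightarrow>
       norm (f x - f (x(j := y))) \<le> c j"
  shows "(\<integral>x. (norm (f x))\<^sup>2 \<partial>PiM I M) \<le> (norm (\<integral>x. f x \<partial>PiM I M))\<^sup>2 + (\<Sum>j\<in>I. (c j)\<^sup>2)"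
  using I f b c
proof (induction I arbitrary: f rule: finite_induct)
  case empty
  show ?case by (simp add: PiM_empty lebesgue_integral_count_space_finite)
next
  case (insert i I)
  interpret product_sigma_finite M
    by (intro product_sigma_finite.intro prob_space_imp_sigma_finite M)
  interpret Mi: prob_space "M i" by (rule M)
  note [measurable] = insert.prems(1)
  define g where "g x = (\<integral>y. f (x(i := y)) \<partial>M i)" for x
  have g[measurable]: "g \<in> borel_measurable (PiM I M)"
    unfolding g_def by (rule borel_measurable_marginal) (simp_all add: M prob_space_imp_sigma_finite)
  have sec: "(\<lambda>y. f (x(i := y))) \<in> borel_measurable (M i)" if "x \<in> space (PiM I M)" for x
    by (rule measurable_compose[OF measurable_component_update[OF that insert.hyps(2)] insert.prems(1)])
  have secb: "norm (f (x(i := y))) \<le> b" if "x \<in> space (PiM I M)" "y \<in> space (M i)" for x y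
    by (intro insert.prems(2) fun_upd_in_space_PiM that)
  have gb: "norm (g x) \<le> b" if "x \<in> space (PiM I M)" for x
    unfolding g_def by (rule norm_integral_prob_le[OF M sec[OF that] secb[OF that]])
  have gc: "norm (g x - g (x(j := y))) \<le> c j"
    if "j \<in> I" "x \<in> space (PiM I M)" "y \<in> space (M j)" for j x y
    unfolding g_def
    by (rule norm_marginal_diff_le[OF M insert.hyps(2) insert.prems(1,2)])
       (assumption, rule insert.prems(3), use that in auto)
  have E: "(\<integral>y. f y \<partial>PiM (insert i I) M) = (\<integral>x. g x \<partial>PiM I M)"
    unfolding g_def
    by (rule product_integral_insert[OF insert.hyps])
       (rule integrable_prob_bounded[OF prob_space_PiM[OF M] insert.prems(1,2)])
  have inner: "(\<integral>y. (norm (f (x(i := y))))\<^sup>2 \<partial>M i) \<le> (norm (g x))\<^sup>2 + (c i)\<^sup>2"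
    if x: "x \<in> space (PiM I M)" for x
  proof -
    have [measurable]: "(\<lambda>y. f (x(i := y))) \<in> borel_measurable (M i)" by (rule sec[OF x])
    have int: "integrable (M i) (\<lambda>y. f (x(i := y)))"
      by (rule integrable_prob_bounded[OF M sec[OF x] secb[OF x]])
    have d: "norm (f (x(i := y)) - g x) \<le> c i" if y: "y \<in> space (M i)" for y
    proof -
      \<comment> \<open>The value at \<open>y\<close> is written as the integral of a constant, so
        that both terms are integrals over the same variable.\<close>
      have "norm ((\<integral>z. f (x(i := y)) \<partial>M i) - (\<integral>z. f (x(i := z)) \<partial>M i)) \<le> c i"
      proof (rule norm_integral_diff_prob_le[OF M _ int])
        fix z assume "z \<in> space (M i)"
        then show "norm (f (x(i := y)) - f (x(i := z))) \<le> c i"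
          using insert.prems(3)[of i "x(i := y)" z] fun_upd_in_space_PiM[of x I M y i] x y
          by (simp del: fun_upd_apply)
      qed simp
      then show ?thesis by (simp add: g_def Mi.prob_space)
    qed
    have int2: "integrable (M i) (\<lambda>y. (norm (f (x(i := y)) - g x))\<^sup>2)"
      by (rule integrable_prob_bounded[OF M, where b = "(c i)\<^sup>2"])
         (auto intro!: power_mono d)
    \<comment> \<open>The remainder beside the squared deviation is affine in \<open>f\<close>,
      hence integrates to \<open>2 * (g x \<bullet> g x) - (norm (g x))^2\<close>, that is, to the
      square of \<open>norm (g x)\<close>.\<close>
    have "(\<integral>y. (norm (f (x(i := y))))\<^sup>2 \<partial>M i)
       = (\<integral>y. (norm (f (x(i := y)) - g x))\<^sup>2 + (2 * (f (x(i := y)) \<bullet> g x) - (norm (g x))\<^sup>2) \<partial>M i)"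
      by (simp add: power2_norm_eq_inner inner_diff inner_commute algebra_simps)
    also have "\<dots> = (\<integral>y. (norm (f (x(i := y)) - g x))\<^sup>2 \<partial>M i) + (2 * (g x \<bullet> g x) - (norm (g x))\<^sup>2)"
      using int int2 by (simp add: g_def Mi.prob_space)
    also have "(\<integral>y. (norm (f (x(i := y)) - g x))\<^sup>2 \<partial>M i) \<le> (\<integral>y. (c i)\<^sup>2 \<partial>M i)"
      using int2 by (intro integral_mono) (auto intro!: power_mono d)
    finally show ?thesis by (simp add: power2_norm_eq_inner Mi.prob_space)
  qed
  have intg: "integrable (PiM I M) (\<lambda>x. (norm (g x))\<^sup>2)"
    by (rule integrable_prob_bounded[OF prob_space_PiM[OF M], where b = "b\<^sup>2"]) (auto intro!: power_mono gb)
  interpret PI: prob_space "PiM I M" by (rule prob_space_PiM[OF M])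
  have "(\<integral>x. (norm (f x))\<^sup>2 \<partial>PiM (insert i I) M)
      = (\<integral>x. (\<integral>y. (norm (f (x(i := y))))\<^sup>2 \<partial>M i) \<partial>PiM I M)"
    by (rule product_integral_insert[OF insert.hyps],
        rule integrable_prob_bounded[OF prob_space_PiM[OF M], where b = "b\<^sup>2"])
       (auto intro!: power_mono insert.prems(2))
  also have "\<dots> \<le> (\<integral>x. (norm (g x))\<^sup>2 + (c i)\<^sup>2 \<partial>PiM I M)"
  proof (rule integral_mono)
    show "integrable (PiM I M) (\<lambda>x. \<integral>y. (norm (f (x(i := y))))\<^sup>2 \<partial>M i)"
    proof (rule integrable_prob_bounded[OF prob_space_PiM[OF M]])
      show "(\<lambda>x. \<integral>y. (norm (f (x(i := y))))\<^sup>2 \<partial>M i) \<in> borel_measurable (PiM I M)"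
        by (rule borel_measurable_marginal) (simp_all add: M prob_space_imp_sigma_finite)
      show "norm (\<integral>y. (norm (f (x(i := y))))\<^sup>2 \<partial>M i) \<le> b\<^sup>2" if x: "x \<in> space (PiM I M)" for x
      proof -
        have [measurable]: "(\<lambda>y. f (x(i := y))) \<in> borel_measurable (M i)" by (rule sec[OF x])
        show ?thesis by (rule norm_integral_prob_le[OF M]) (auto intro!: power_mono secb x)
      qed
    qed
  qed (use intg inner in auto)
  also have "\<dots> = (\<integral>x. (norm (g x))\<^sup>2 \<partial>PiM I M) + (c i)\<^sup>2"
    using intg by (simp add: PI.prob_space)
  also have "\<dots> \<le> (norm (\<integral>x. g x \<partial>PiM I M))\<^sup>2 + (\<Sum>j\<in>I. (c j)\<^sup>2) + (c i)\<^sup>2"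
    by (intro add_right_mono insert.IH g gb gc)
  finally show ?case using insert.hyps by (simp add: E)
qed

text \<open>The gap between the two sides is the variance of \<open>norm (f x)\<close>.\<close>

lemma norm_integral_le_L2:
  assumes M: "prob_space M" and f: "f \<in> borel_measurable M"
    and b: "\<And>x. x \<in> space M \<Longrightarrow> norm (f x) \<le> b"
  shows "(\<integral>x. norm (f x) \<partial>M)\<^sup>2 \<le> (\<integral>x. (norm (f x))\<^sup>2 \<partial>M)"
proof -
  interpret prob_space M by fact
  have i: "integrable M (\<lambda>x. norm (f x))" "integrable M (\<lambda>x. (norm (f x))\<^sup>2)"
    by (rule integrable_prob_bounded[OF M, of _ b] integrable_prob_bounded[OF M, of _ "b\<^sup>2"];
        use f b in \<open>auto intro!: power_mono\<close>)+
  show ?thesis using variance_eq[OF i] variance_positive[of "\<lambda>x. norm (f x)"] by simp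
qed

text \<open>
  McDiarmid's inequality for the scalar \<open>norm (f x)\<close> together with the crude bound
  \<open>E (norm f) \<le> norm (E f) + \<nu> sqrt N\<close> loses nothing against a Hilbert-space martingale inequality,
  because \<open>1 + sqrt (l / 2) \<le> sqrt (2 (ln 2 + l))\<close>; this needs \<open>ln 2 \<ge> 2 / 3\<close>.\<close>

lemma vector_McDiarmid:
  fixes f :: "('i \<Rightarrow> 'a) \<Rightarrow> 'b::euclidean_space"
  assumes M: "\<And>j. prob_space (M j)" and I: "finite I" "I \<noteq> {}"
    and f[measurable]: "f \<in> borel_measurable (PiM I M)"
    and b: "\<And>x. x \<in> space (PiM I M) \<Longrightarrow> norm (f x) \<le> b"
    and c: "\<And>j x y. j \<in> I \<Longrightarrow> x \<in> space (PiM I M) \<Longrightarrow> y \<in> space (M j) \<Longrightarrow>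
       norm (f x - f (x(j := y))) \<le> \<nu>"
    and \<nu>: "0 < \<nu>" and \<delta>: "0 < \<delta>" "\<delta> < 1"
  shows "measure (PiM I M) {x\<in>space (PiM I M). norm (f x) \<le>
      norm (\<integral>x. f x \<partial>PiM I M) + \<nu> * sqrt (2 * real (card I) * ln (2 / \<delta>))} \<ge> 1 - \<delta>"
proof -
  interpret P: prob_space "PiM I M" by (rule prob_space_PiM[OF M])
  define N where "N = real (card I)"
  have N: "0 < N" using I by (simp add: N_def card_gt_0_iff)
  define e where "e = (\<integral>x. norm (f x) \<partial>PiM I M)"
  define m where "m = norm (\<integral>x. f x \<partial>PiM I M)"
  \<comment> \<open>Chosen so that \<open>exp (- 2 * u^2) = \<delta>\<close>: the scalar inequality
    at deviation \<open>\<nu> * sqrt N * u\<close> then fails with probability at most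
    \<delta>.\<close>
  define u where "u = sqrt (ln (1 / \<delta>) / 2)"
  have l: "0 < ln (1 / \<delta>)" using \<delta> by simp
  then have u: "0 < u" "u\<^sup>2 = ln (1 / \<delta>) / 2" by (simp_all add: u_def)
  define t where "t = \<nu> * sqrt N * u"
  have t: "0 < t" using \<nu> N u by (simp add: t_def)
  have "e\<^sup>2 \<le> m\<^sup>2 + N * \<nu>\<^sup>2"
    using norm_integral_le_L2[OF P.prob_space_axioms f b] second_moment_le_bounded_differences[OF M I(1) f b c]
    by (simp add: e_def m_def N_def)
  also have "\<dots> \<le> (m + \<nu> * sqrt N)\<^sup>2"
    using \<nu> N by (simp add: power2_sum power_mult_distrib m_def)
  finally have e: "e \<le> m + \<nu> * sqrt N"
    by (rule power2_le_imp_le) (use \<nu> N in \<open>simp add: m_def\<close>)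
  have "(1 + u)\<^sup>2 \<le> 2 * ln (2 / \<delta>)"
  proof -
    have "2 * ln (2 / \<delta>) = 2 * ln 2 + 4 * u\<^sup>2" using \<delta> by (simp add: u ln_div)
    \<comment> \<open>Completing the square: \<open>4 / 3 + 4 * u^2\<close> exceeds
      \<open>(1 + u)^2\<close> by a square vanishing at \<open>u = 1 / 3\<close>, and
      \<open>4 / 3\<close> is the lower bound for \<open>2 * ln 2\<close>.\<close>
    moreover have "(1 + u)\<^sup>2 + 3 * (u - 1 / 3)\<^sup>2 = 4 / 3 + 4 * u\<^sup>2"
      by (simp add: power2_eq_square algebra_simps)
    moreover have "0 \<le> 3 * (u - 1 / 3)\<^sup>2" by simp
    ultimately show ?thesis using ln2_ge_two_thirds by linarith
  qed
  then have "N * (1 + u)\<^sup>2 \<le> N * (2 * ln (2 / \<delta>))" using N by (intro mult_left_mono) auto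
  then have "sqrt N * (1 + u) \<le> sqrt (2 * N * ln (2 / \<delta>))"
    using N by (intro real_le_rsqrt) (simp add: power_mult_distrib mult_ac)
  then have "\<nu> * (sqrt N * (1 + u)) \<le> \<nu> * sqrt (2 * N * ln (2 / \<delta>))"
    using \<nu> by (intro mult_left_mono) auto
  with e have et: "e + t \<le> m + \<nu> * sqrt (2 * N * ln (2 / \<delta>))"
    by (simp add: t_def algebra_simps)
  have V: "(\<Sum>j\<in>I. \<nu>\<^sup>2) = N * \<nu>\<^sup>2" by (simp add: N_def)
  have "P.prob {x\<in>space (PiM I M). e + t < norm (f x)} \<le> exp (- 2 * t\<^sup>2 / (\<Sum>j\<in>I. \<nu>\<^sup>2))"
    unfolding e_def
  proof (rule McDiarmid_ineq_gt[OF M I(1) _ _ _ _ t])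
    show "norm (norm (f x) - norm (f (x(j := y)))) \<le> \<nu>"
      if "j \<in> I" "x \<in> space (PiM I M)" "y \<in> space (M j)" for j x y
      using order_trans[OF norm_triangle_ineq3 c[OF that]] by simp
    show "norm (norm (f x)) \<le> b" if "x \<in> space (PiM I M)" for x using b[OF that] by simp
  qed (use N \<nu> V in simp_all)
  also have "- 2 * t\<^sup>2 / (\<Sum>j\<in>I. \<nu>\<^sup>2) = - ln (1 / \<delta>)"
    unfolding V using \<nu> N by (simp add: t_def power_mult_distrib u)
  also have "exp (- ln (1 / \<delta>)) = \<delta>" using \<delta> by (simp add: ln_div)
  finally have "1 - \<delta> \<le> 1 - P.prob {x\<in>space (PiM I M). e + t < norm (f x)}" by simp
  also have "\<dots> = P.prob {x\<in>space (PiM I M). \<not> e + t < norm (f x)}"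
    by (rule P.prob_neg[symmetric]) measurable
  also have "\<dots> \<le> P.prob {x\<in>space (PiM I M). norm (f x) \<le> m + \<nu> * sqrt (2 * N * ln (2 / \<delta>))}"
    using et by (intro P.finite_measure_mono) auto
  finally show ?thesis by (simp add: m_def N_def)
qed

subsection \<open>Resolvents of maximally monotone operators\<close>

lemma convex_halfspace_inner3:
  fixes a b :: "'a::real_inner"
  shows "convex {p :: 'a \<times> 'a \<times> real. fst p \<bullet> a + fst (snd p) \<bullet> b \<le> snd (snd p) + c}"
proof (rule convexI)
  fix p q :: "'a \<times> 'a \<times> real" and u v :: real
  assume p: "p \<in> {p. fst p \<bullet> a + fst (snd p) \<bullet> b \<le> snd (snd p) + c}"
    and q: "q \<in> {p. fst p \<bullet> a + fst (snd p) \<bullet> b \<le> snd (snd p) + c}"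
    and uv: "0 \<le> u" "0 \<le> v" "u + v = 1"
  have "u * (fst p \<bullet> a + fst (snd p) \<bullet> b) + v * (fst q \<bullet> a + fst (snd q) \<bullet> b)
      \<le> u * (snd (snd p) + c) + v * (snd (snd q) + c)"
    using p q uv by (intro add_mono[OF mult_left_mono mult_left_mono]) auto
  also have "\<dots> = u * snd (snd p) + v * snd (snd q) + (u + v) * c" by (simp add: algebra_simps)
  finally show "u *\<^sub>R p + v *\<^sub>R q \<in> {p. fst p \<bullet> a + fst (snd p) \<bullet> b \<le> snd (snd p) + c}"
    using uv by (simp add: inner_add_left algebra_simps)
qed

text \<open>
  The third coordinate carries the value of the form \<open>y \<bullet> v\<close>: monotonicity of the pairs says
  exactly that this lifting lies above the form on the whole convex hull.\<close>

lemma hull_lift_ge_inner: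
  fixes S :: "('a::real_inner \<times> 'a) set"
  assumes mono: "\<And>y v y' v'. (y, v) \<in> S \<Longrightarrow> (y', v') \<in> S \<Longrightarrow> 0 \<le> (y - y') \<bullet> (v - v')"
    and p: "(y, v, r) \<in> convex hull ((\<lambda>(y, v). (y, v, y \<bullet> v)) ` S)"
  shows "y \<bullet> v \<le> r"
proof -
  let ?L = "(\<lambda>(y, v). (y, v, y \<bullet> v)) ` S"
  have half: "fst p \<bullet> b + fst (snd p) \<bullet> a \<le> snd (snd p) + a \<bullet> b" if "(a, b) \<in> S" "p \<in> convex hull ?L" for a b p
  proof -
    have "convex hull ?L \<subseteq> {p. fst p \<bullet> b + fst (snd p) \<bullet> a \<le> snd (snd p) + a \<bullet> b}"
    proof (rule hull_minimal)
      show "?L \<subseteq> {p. fst p \<bullet> b + fst (snd p) \<bullet> a \<le> snd (snd p) + a \<bullet> b}"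
        using mono[OF _ \<open>(a, b) \<in> S\<close>] by (force simp: inner_diff inner_commute algebra_simps)
    qed (rule convex_halfspace_inner3)
    then show ?thesis using that by blast
  qed
  \<comment> \<open>The second passage to the hull. \<open>half\<close> is now read with the hull
    point \<open>(y, v, r)\<close> fixed and the generator varying; comparing the hull point with
    itself then gives twice the claim.\<close>
  have "convex hull ?L \<subseteq> {q. fst q \<bullet> v + fst (snd q) \<bullet> y \<le> snd (snd q) + r}"
  proof (rule hull_minimal)
    show "?L \<subseteq> {q. fst q \<bullet> v + fst (snd q) \<bullet> y \<le> snd (snd q) + r}"
      using half[OF _ p] by (force simp: inner_commute algebra_simps)
  qed (rule convex_halfspace_inner3)
  with p have "y \<bullet> v + v \<bullet> y \<le> r + r" by auto
  then show ?thesis by (simp add: inner_commute)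
qed

text \<open>
  The witness is half the difference of the two components of the point of the lifted convex hull
  that minimises \<open>norm (y - v)\<^sup>2 / 4 + r\<close>; the inequalities are its first-order optimality conditions.\<close>

lemma finite_monotone_extension:
  fixes S :: "('a::euclidean_space \<times> 'a) set"
  assumes fin: "finite S"
    and mono: "\<And>y v y' v'. (y, v) \<in> S \<Longrightarrow> (y', v') \<in> S \<Longrightarrow> 0 \<le> (y - y') \<bullet> (v - v')"
  obtains x where "\<And>y v. (y, v) \<in> S \<Longrightarrow> (x - y) \<bullet> (x + v) \<le> 0"
proof (cases "S = {}")
  case True
  then show ?thesis using that by simp
next
  case False
  define L where "L = convex hull ((\<lambda>(y, v). (y, v, y \<bullet> v)) ` S)"
  define x :: "'a \<times> 'a \<times> real \<Rightarrow> 'a" where "x p = (1/2) *\<^sub>R (fst p - fst (snd p))" for p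
  define F where "F p = x p \<bullet> x p + snd (snd p)" for p :: "'a \<times> 'a \<times> real"
  have "compact L" unfolding L_def by (intro finite_imp_compact_convex_hull finite_imageI fin)
  moreover have "L \<noteq> {}" using False by (simp add: L_def)
  moreover have "continuous_on L F" unfolding F_def x_def by (intro continuous_intros)
  ultimately obtain p where p: "p \<in> L" and min: "\<And>q. q \<in> L \<Longrightarrow> F p \<le> F q"
    using continuous_attains_inf[of L F] by blast
  \<comment> \<open>For \<open>p = (y, v, r)\<close>, the lifting gives
    \<open>r \<ge> y \<bullet> v\<close>, so \<open>F p\<close> is at least a quarter of the square
    of \<open>norm (y + v)\<close>.\<close>
  have "fst p \<bullet> fst (snd p) \<le> snd (snd p)"
    using hull_lift_ge_inner[OF mono, of S "fst p" "fst (snd p)" "snd (snd p)"] p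
    by (simp add: L_def)
  moreover have "0 \<le> (fst p + fst (snd p)) \<bullet> (fst p + fst (snd p))" by simp
  ultimately have F0: "0 \<le> F p"
    by (simp add: F_def x_def inner_diff inner_add inner_commute algebra_simps)
  show ?thesis
  proof (rule that[of "x p"])
    fix y v assume "(y, v) \<in> S"
    then have q: "(y, v, y \<bullet> v) \<in> L" unfolding L_def by (intro hull_inc) force
    define q where "q = (y, v, y \<bullet> v)"
    \<comment> \<open>\<open>D\<close> is the derivative of \<open>F\<close> at \<open>p\<close> in
      the direction \<open>q - p\<close>, and \<open>w\<close> the quadratic coefficient along the
      segment.\<close>
    define D where "D = 2 * (x p \<bullet> (x q - x p)) + (snd (snd q) - snd (snd p))"
    define w where "w = (x q - x p) \<bullet> (x q - x p)"
    have "0 \<le> D + t * w" if t: "0 < t" "t < 1" for t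
    proof -
      have "p + t *\<^sub>R (q - p) \<in> L"
        using convexD_alt[OF convex_convex_hull, of p _ q t] p q t
        by (simp add: L_def q_def[symmetric] algebra_simps)
      then have "F p \<le> F (p + t *\<^sub>R (q - p))" by (rule min)
      also have "F (p + t *\<^sub>R (q - p)) = F p + t * (D + t * w)"
      proof -
        have x: "x (p + t *\<^sub>R (q - p)) = x p + t *\<^sub>R (x q - x p)"
          by (simp add: x_def algebra_simps)
        show ?thesis unfolding F_def D_def w_def x
          by (simp add: inner_add inner_diff inner_commute algebra_simps)
      qed
      finally show ?thesis using t by (simp add: zero_le_mult_iff)
    qed
    then have "eventually (\<lambda>t. 0 \<le> D + t * w) (at_right 0)"
      by (intro eventually_at_rightI[of 0 1]) auto
    moreover have "((\<lambda>t. D + t * w) \<longlongrightarrow> D + 0 * w) (at_right 0)" by (intro tendsto_intros)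
    ultimately have "0 \<le> D + 0 * w"
      by (intro tendsto_lowerbound) auto
    \<comment> \<open>The left-hand side is exactly \<open>- D - F p\<close>.\<close>
    then show "(x p - y) \<bullet> (x p + v) \<le> 0"
      using F0 by (simp add: D_def F_def q_def x_def inner_diff inner_add inner_commute algebra_simps)
  qed
qed

text \<open>Thales: an angle of at least 90 degrees over the segment from \<open>a\<close> to
  \<open>b\<close> characterises the closed ball having that segment as diameter. It turns a
  monotonicity condition into a compact set.\<close>

lemma ball_of_diameter:
  fixes x a b :: "'a::real_inner"
  shows "(x - a) \<bullet> (x - b) \<le> 0 \<longleftrightarrow> x \<in> cball ((1/2) *\<^sub>R (a + b)) (norm (a - b) / 2)"
proof -
  have "x \<in> cball ((1/2) *\<^sub>R (a + b)) (norm (a - b) / 2)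
      \<longleftrightarrow> (norm ((1/2) *\<^sub>R (a + b) - x))\<^sup>2 \<le> (norm (a - b) / 2)\<^sup>2"
    by (simp add: dist_norm abs_le_square_iff[symmetric])
  also have "\<dots> \<longleftrightarrow> (x - a) \<bullet> (x - b) \<le> 0"
    by (auto simp: power_divide power2_norm_eq_inner inner_diff inner_add inner_commute algebra_simps)
  finally show ?thesis by simp
qed

text \<open>A solution must have \<open>u = (z - x) / \<gamma>\<close>. Monotonicity of
  \<open>(x, u)\<close> against a pair \<open>(y, v)\<close> of the graph, multiplied by \<gamma>,
  reads \<open>(x - y) \<bullet> (x - (z - \<gamma> *\<^sub>R v)) \<le> 0\<close> and confines
  \<open>x\<close> to a ball. A point common to all balls gives a pair that extends the graph
  monotonically, so maximality puts it into the graph.\<close>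

theorem Minty:
  fixes A :: "'a::euclidean_space operator"
  assumes A: "maximally_monotone A" and \<gamma>: "0 < \<gamma>"
  shows "\<exists>x. \<exists>u\<in>A x. z = x + \<gamma> *\<^sub>R u"
proof -
  have monoA: "0 \<le> (x - y) \<bullet> (u - v)" if "u \<in> A x" "v \<in> A y" for x y u v
    using A that by (auto simp: maximally_monotone_def monotone_operator_def)
  have maxA: "A' = A" if "monotone_operator A'" "\<And>x. A x \<subseteq> A' x" for A'
    using A that by (auto simp: maximally_monotone_def)
  define b where
    "b p = cball ((1/2) *\<^sub>R (fst p + (z - \<gamma> *\<^sub>R snd p))) (norm (fst p - (z - \<gamma> *\<^sub>R snd p)) / 2)"
    for p
  have b: "x \<in> b (y, v) \<longleftrightarrow> (x - y) \<bullet> (x - (z - \<gamma> *\<^sub>R v)) \<le> 0" for x y v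
    by (simp add: b_def ball_of_diameter)
  define Gr where "Gr = {(y, v). v \<in> A y}"
  have "\<Inter>(b ` Gr) \<noteq> {}"
  proof (rule compact_fip_Heine_Borel)
    show "compact T" if "T \<in> b ` Gr" for T using that by (auto simp: b_def)
    fix \<F> assume "finite \<F>" "\<F> \<subseteq> b ` Gr"
    then obtain S where S: "S \<subseteq> Gr" "finite S" "\<F> = b ` S"
      by (meson finite_subset_image)
    \<comment> \<open>Scaling by \<gamma> and shifting by \<open>z\<close> keep the pairs monotone
      and bring the ball condition into the form \<open>(x - y) \<bullet> (x + v) \<le> 0\<close> of
      the finite extension lemma.\<close>
    let ?T = "(\<lambda>(y, v). (y, \<gamma> *\<^sub>R v - z)) ` S"
    have "0 \<le> (y - y') \<bullet> (v - v')" if "(y, v) \<in> ?T" "(y', v') \<in> ?T" for y v y' v'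
    proof -
      from that obtain u u' where u: "(y, u) \<in> S" "v = \<gamma> *\<^sub>R u - z" "(y', u') \<in> S" "v' = \<gamma> *\<^sub>R u' - z"
        by auto
      then have "0 \<le> \<gamma> * ((y - y') \<bullet> (u - u'))"
        using S(1) \<gamma> by (intro mult_nonneg_nonneg monoA) (auto simp: Gr_def)
      also have "\<dots> = (y - y') \<bullet> (v - v')" by (simp add: u algebra_simps inner_diff)
      finally show ?thesis .
    qed
    with finite_monotone_extension[of ?T] S(2)
    obtain x where x: "\<And>y v. (y, v) \<in> ?T \<Longrightarrow> (x - y) \<bullet> (x + v) \<le> 0" by blast
    have "x \<in> b (y, v)" if "(y, v) \<in> S" for y v
      using x[of y "\<gamma> *\<^sub>R v - z"] that by (force simp: b algebra_simps)
    then have "x \<in> \<Inter>\<F>" unfolding S(3) by auto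
    then show "\<Inter>\<F> \<noteq> {}" by blast
  qed
  then obtain x where "\<And>y v. v \<in> A y \<Longrightarrow> x \<in> b (y, v)"
    by (auto simp: Gr_def)
  then have x: "(x - y) \<bullet> (x - (z - \<gamma> *\<^sub>R v)) \<le> 0" if "v \<in> A y" for y v
    using that by (simp add: b)
  define u where "u = (1/\<gamma>) *\<^sub>R (z - x)"
  have zu: "z = x + \<gamma> *\<^sub>R u" using \<gamma> by (simp add: u_def)
  have xu: "0 \<le> (x - y) \<bullet> (u - v)" if "v \<in> A y" for y v
  proof -
    have "\<gamma> * ((x - y) \<bullet> (u - v)) = - ((x - y) \<bullet> (x - (z - \<gamma> *\<^sub>R v)))"
      by (simp add: zu algebra_simps inner_diff)
    with x[OF that] have "0 \<le> \<gamma> * ((x - y) \<bullet> (u - v))" by linarith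
    with \<gamma> show ?thesis by (simp add: zero_le_mult_iff)
  qed
  have "A(x := insert u (A x)) = A"
  proof (rule maxA)
    have "(y - x) \<bullet> (v - u) = (x - y) \<bullet> (u - v)" for y v by (simp add: inner_diff algebra_simps)
    then show "monotone_operator (A(x := insert u (A x)))"
      by (auto simp: monotone_operator_def xu monoA)
  qed auto
  then have "u \<in> A x" by (metis fun_upd_same insertI1)
  with zu show ?thesis by blast
qed

text \<open>\<open>ne\<close> does double duty: it is the estimate itself, and for equal right-hand
  sides it is the uniqueness that the definite description needs. Existence is Minty's
  theorem.\<close>

lemma resolvent_nonexpansive:
  fixes A :: "'a::euclidean_space operator"
  assumes A: "maximally_monotone A" and \<gamma>: "0 < \<gamma>"
  shows "norm (resolvent \<gamma> A z - resolvent \<gamma> A z') \<le> norm (z - z')"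
proof -
  have ne: "norm (x - y) \<le> norm ((x + \<gamma> *\<^sub>R u) - (y + \<gamma> *\<^sub>R v))" if uv: "u \<in> A x" "v \<in> A y" for x y u v
  proof -
    have "0 \<le> \<gamma> * ((x - y) \<bullet> (u - v))"
      using A \<gamma> uv by (simp add: maximally_monotone_def monotone_operator_def)
    then have "(norm (x - y))\<^sup>2 \<le> (x - y) \<bullet> ((x + \<gamma> *\<^sub>R u) - (y + \<gamma> *\<^sub>R v))"
      by (simp add: power2_norm_eq_inner inner_diff inner_add algebra_simps)
    also have "\<dots> \<le> norm (x - y) * norm ((x + \<gamma> *\<^sub>R u) - (y + \<gamma> *\<^sub>R v))"
      by (rule norm_cauchy_schwarz)
    finally show ?thesis
      by (cases "x = y") (simp_all add: power2_eq_square)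
  qed
  have res: "\<exists>u\<in>A (resolvent \<gamma> A w). w = resolvent \<gamma> A w + \<gamma> *\<^sub>R u" for w
    unfolding resolvent_def
  proof (rule theI')
    obtain x u where xu: "u \<in> A x" "w = x + \<gamma> *\<^sub>R u" using Minty[OF A \<gamma>] by blast
    have "y = x" if "v \<in> A y" "w = y + \<gamma> *\<^sub>R v" for y v
      using ne[OF that(1) xu(1)] that(2) xu(2) by simp
    with xu show "\<exists>!x. \<exists>u\<in>A x. w = x + \<gamma> *\<^sub>R u" by (intro ex_ex1I) blast+
  qed
  show ?thesis using ne res[of z] res[of z'] by metis
qed

lemma cocoercive_imp_lipschitz:
  assumes F: "cocoercive \<theta> F" and \<theta>: "0 < \<theta>"
  shows "norm (F x - F y) \<le> norm (x - y) / \<theta>"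
proof -
  have "\<theta> * (norm (F x - F y))\<^sup>2 \<le> (x - y) \<bullet> (F x - F y)"
    using F by (simp add: cocoercive_def)
  also have "\<dots> \<le> norm (x - y) * norm (F x - F y)" by (rule norm_cauchy_schwarz)
  finally have "\<theta> * norm (F x - F y) \<le> norm (x - y)"
    by (cases "F x = F y") (simp_all add: power2_eq_square)
  then show ?thesis using \<theta> by (simp add: field_simps)
qed

subsection \<open>The Davis--Yin iteration\<close>

text \<open>Needed because the oracle is evaluated at an iterate that itself depends on the data.
  For \<open>h\<close> with finite range, measurability in the second argument suffices; simple
  functions converging to \<open>h\<close> and continuity in the first argument do the rest.\<close>

lemma borel_measurable_caratheodory:
  fixes F :: "'a::{metric_space, second_countable_topology} \<Rightarrow> 'b \<Rightarrow> 'c::metric_space"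
  assumes h: "h \<in> borel_measurable M" and k: "k \<in> measurable M P"
    and F: "\<And>x. F x \<in> borel_measurable P"
    and cont: "\<And>y. y \<in> space P \<Longrightarrow> continuous_on UNIV (\<lambda>x. F x y)"
  shows "(\<lambda>w. F (h w) (k w)) \<in> borel_measurable M"
proof -
  obtain s where s: "\<And>i. simple_function M (s i)"
    and lim: "\<And>w. w \<in> space M \<Longrightarrow> (\<lambda>i. s i w) \<longlonglongrightarrow> h w"
    using borel_measurable_implies_sequence_metric[OF h, of undefined] by blast
  have "(\<lambda>w. F (s i w) (k w)) \<in> borel_measurable M" for i
  proof (rule measurable_compose_countable'[where g = "s i" and I = "s i ` space M"])
    show "(\<lambda>w. F x (k w)) \<in> borel_measurable M" for x by (rule measurable_compose[OF k F])
    show "countable (s i ` space M)" using s[of i] by (simp add: simple_function_def countable_finite)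
    then show "s i \<in> measurable M (count_space (s i ` space M))"
      using s[of i] by (auto simp: measurable_count_space_eq2 simple_function_def)
  qed
  then show ?thesis
  proof (rule borel_measurable_LIMSEQ_metric)
    fix w assume w: "w \<in> space M"
    show "(\<lambda>i. F (s i w) (k w)) \<longlonglongrightarrow> F (h w) (k w)"
      by (rule continuous_on_tendsto_compose[OF cont lim[OF w]])
         (use measurable_space[OF k w] in auto)
  qed
qed

lemma continuous_on_lipschitz_bound:
  fixes F :: "'a::real_normed_vector \<Rightarrow> 'b::real_normed_vector"
  assumes L: "\<And>x y. norm (F x - F y) \<le> L * norm (x - y)"
  shows "continuous_on UNIV F"
proof -
  have "norm (F x - F y) \<le> \<bar>L\<bar> * norm (x - y)" for x y
    by (rule order_trans[OF L]) (simp add: mult_right_mono)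
  then have "\<bar>L\<bar>-lipschitz_on UNIV F" by (intro lipschitz_onI) (auto simp: dist_norm)
  then show ?thesis by (rule lipschitz_on_continuous_on)
qed

text \<open>Both operators evaluate their forward map at the same point, so only the argument of the
  outer resolvent moves. This serves the stability of the iteration and also the final residual
  bound.\<close>

lemma dy_operator_perturbation:
  fixes A B :: "'a::euclidean_space operator"
  assumes A: "maximally_monotone A" and \<gamma>: "0 < \<gamma>"
  shows "norm (dy_operator \<gamma> A B F z - dy_operator \<gamma> A B F' z)
    \<le> \<gamma> * norm (F (resolvent \<gamma> B z) - F' (resolvent \<gamma> B z))"
proof -
  let ?x = "resolvent \<gamma> B z"
  have "norm (dy_operator \<gamma> A B F z - dy_operator \<gamma> A B F' z)
      = norm (resolvent \<gamma> A (2 *\<^sub>R ?x - z - \<gamma> *\<^sub>R F ?x) - resolvent \<gamma> A (2 *\<^sub>R ?x - z - \<gamma> *\<^sub>R F' ?x))"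
    by (simp add: dy_operator_def)
  also have "\<dots> \<le> norm ((2 *\<^sub>R ?x - z - \<gamma> *\<^sub>R F ?x) - (2 *\<^sub>R ?x - z - \<gamma> *\<^sub>R F' ?x))"
    by (rule resolvent_nonexpansive[OF A \<gamma>])
  also have "\<dots> = norm (\<gamma> *\<^sub>R (F' ?x - F ?x))" by (simp add: algebra_simps)
  finally show ?thesis using \<gamma> by (simp add: norm_minus_commute)
qed

text \<open>The constant collects 1 from \<open>z\<close>, 1 from \<open>x\<close> and
  \<open>3 + \<gamma> * L\<close> from \<open>y\<close>. It only serves to show the sensitivity
  finite and does not enter the final bound.\<close>

lemma dy_operator_lipschitz:
  fixes A B :: "'a::euclidean_space operator"
  assumes A: "maximally_monotone A" and B: "maximally_monotone B" and \<gamma>: "0 < \<gamma>"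
    and L: "\<And>x y. norm (F x - F y) \<le> L * norm (x - y)" and "0 \<le> L"
  shows "norm (dy_operator \<gamma> A B F z - dy_operator \<gamma> A B F z') \<le> (5 + \<gamma> * L) * norm (z - z')"
proof -
  define x where "x = resolvent \<gamma> B z"
  define x' where "x' = resolvent \<gamma> B z'"
  define y where "y = resolvent \<gamma> A (2 *\<^sub>R x - z - \<gamma> *\<^sub>R F x)"
  define y' where "y' = resolvent \<gamma> A (2 *\<^sub>R x' - z' - \<gamma> *\<^sub>R F x')"
  have x: "norm (x - x') \<le> norm (z - z')"
    unfolding x_def x'_def by (rule resolvent_nonexpansive[OF B \<gamma>])
  have "norm (F x - F x') \<le> L * norm (z - z')"
    using L[of x x'] x \<open>0 \<le> L\<close> by (meson mult_left_mono order_trans)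
  then have Fx: "norm (\<gamma> *\<^sub>R (F x - F x')) \<le> \<gamma> * (L * norm (z - z'))"
    using \<gamma> by simp
  have "norm (y - y') \<le> norm ((2 *\<^sub>R x - z - \<gamma> *\<^sub>R F x) - (2 *\<^sub>R x' - z' - \<gamma> *\<^sub>R F x'))"
    unfolding y_def y'_def by (rule resolvent_nonexpansive[OF A \<gamma>])
  also have "(2 *\<^sub>R x - z - \<gamma> *\<^sub>R F x) - (2 *\<^sub>R x' - z' - \<gamma> *\<^sub>R F x')
      = 2 *\<^sub>R (x - x') - (z - z') - \<gamma> *\<^sub>R (F x - F x')" by (simp add: algebra_simps)
  also have "norm \<dots> \<le> 2 * norm (x - x') + norm (z - z') + norm (\<gamma> *\<^sub>R (F x - F x'))"
    using norm_triangle_ineq4[of "2 *\<^sub>R (x - x') - (z - z')" "\<gamma> *\<^sub>R (F x - F x')"]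
      norm_triangle_ineq4[of "2 *\<^sub>R (x - x')" "z - z'"] by simp
  finally have y: "norm (y - y') \<le> 3 * norm (z - z') + \<gamma> * (L * norm (z - z'))"
    using x Fx by linarith
  have "dy_operator \<gamma> A B F z - dy_operator \<gamma> A B F z' = (z - z') - (x - x') + (y - y')"
    by (simp add: dy_operator_def x_def x'_def y_def y'_def algebra_simps)
  also have "norm \<dots> \<le> norm (z - z') + norm (x - x') + norm (y - y')"
    using norm_triangle_ineq[of "(z - z') - (x - x')" "y - y'"] norm_triangle_ineq4[of "z - z'" "x - x'"]
    by linarith
  finally show ?thesis using x y by (simp add: algebra_simps)
qed

text \<open>Discrete Gronwall: each step multiplies the old distance by at most
  \<open>5 + \<gamma> * L\<close> and adds at most \<open>\<gamma> * e\<close>.\<close>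

lemma dy_z_perturbation:
  fixes A B :: "'a::euclidean_space operator"
  assumes A: "maximally_monotone A" and B: "maximally_monotone B" and \<gamma>: "0 < \<gamma>"
    and L: "\<And>x y. norm (F x - F y) \<le> L * norm (x - y)" and "0 \<le> L"
    and e: "\<And>x. norm (F x - F' x) \<le> e"
  shows "norm (dy_z \<gamma> A B F z0 t - dy_z \<gamma> A B F' z0 t) \<le> \<gamma> * e * (\<Sum>k<t. (5 + \<gamma> * L) ^ k)"
proof (induction t)
  case 0
  show ?case by simp
next
  case (Suc t)
  define z where "z = dy_z \<gamma> A B F z0 t"
  define z' where "z' = dy_z \<gamma> A B F' z0 t"
  have "norm (dy_operator \<gamma> A B F z - dy_operator \<gamma> A B F' z')
     \<le> norm (dy_operator \<gamma> A B F z - dy_operator \<gamma> A B F z')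
       + norm (dy_operator \<gamma> A B F z' - dy_operator \<gamma> A B F' z')"
    using norm_triangle_ineq[of "dy_operator \<gamma> A B F z - dy_operator \<gamma> A B F z'"
        "dy_operator \<gamma> A B F z' - dy_operator \<gamma> A B F' z'"] by simp
  also have "\<dots> \<le> (5 + \<gamma> * L) * norm (z - z') + \<gamma> * e"
    by (intro add_mono dy_operator_lipschitz[OF A B \<gamma> L \<open>0 \<le> L\<close>]
          order_trans[OF dy_operator_perturbation[OF A \<gamma>]] mult_left_mono e) (use \<gamma> in auto)
  also have "\<dots> \<le> (5 + \<gamma> * L) * (\<gamma> * e * (\<Sum>k<t. (5 + \<gamma> * L) ^ k)) + \<gamma> * e"
    using Suc \<gamma> \<open>0 \<le> L\<close> by (intro add_right_mono mult_left_mono) (auto simp: z_def z'_def)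
  also have "\<dots> = \<gamma> * e * (\<Sum>k<Suc t. (5 + \<gamma> * L) ^ k)"
    unfolding sum.lessThan_Suc_shift by (simp add: sum_distrib_left distrib_left mult_ac)
  finally show ?case by (simp add: dy_z_Suc z_def z'_def del: dy_z.simps)
qed

lemma empirical_map_lipschitz:
  assumes N: "1 \<le> N" and L: "\<And>i x y. i \<in> {1..N} \<Longrightarrow> norm (G x (D i) - G y (D i)) \<le> L * norm (x - y)"
  shows "norm (empirical_map G N D x - empirical_map G N D y) \<le> L * norm (x - y)"
proof -
  have "norm (\<Sum>i=1..N. G x (D i) - G y (D i)) \<le> (\<Sum>i=1..N. L * norm (x - y))"
    by (rule sum_norm_le) (rule L)
  also have "\<dots> = real N * (L * norm (x - y))" by simp
  also have "(\<Sum>i=1..N. G x (D i) - G y (D i)) = (\<Sum>i=1..N. G x (D i)) - (\<Sum>i=1..N. G y (D i))"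
    by (rule sum_subtractf)
  finally have "norm ((\<Sum>i=1..N. G x (D i)) - (\<Sum>i=1..N. G y (D i))) / N \<le> L * norm (x - y)"
    using N by (simp add: divide_le_eq mult_ac)
  then show ?thesis
    unfolding empirical_map_def scaleR_diff_right[symmetric] by simp
qed

lemma norm_empirical_map_replace_one:
  assumes i: "i \<in> {1..N}"
  shows "norm (empirical_map G N D x - empirical_map G N (D(i := y)) x) = norm (G x (D i) - G x y) / N"
proof -
  have "(\<Sum>j=1..N. G x (D j)) - (\<Sum>j=1..N. G x ((D(i := y)) j))
      = (\<Sum>j=1..N. if j = i then G x (D i) - G x y else 0)"
    unfolding sum_subtractf[symmetric] by (intro sum.cong) auto
  also have "\<dots> = G x (D i) - G x y" using i by simp
  finally show ?thesis
    unfolding empirical_map_def scaleR_diff_right[symmetric] by (simp del: fun_upd_apply)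
qed

text \<open>The content is boundedness of the family under the supremum. Swapping one sample moves
  the empirical map by at most \<open>\<sigma> / N\<close> everywhere, and the perturbation bound
  carries this to step \<open>K\<close> uniformly in the dataset.\<close>

lemma replace_one_sensitivity_ge:
  fixes A B :: "'a::euclidean_space operator"
  assumes A: "maximally_monotone A" and B: "maximally_monotone B" and \<gamma>: "0 < \<gamma>" and \<theta>: "0 < \<theta>"
    and coco: "\<And>\<xi>. \<xi> \<in> \<Xi> \<Longrightarrow> cocoercive \<theta> (\<lambda>x. G x \<xi>)"
    and osc: "\<And>x \<xi> \<xi>'. \<xi> \<in> \<Xi> \<Longrightarrow> \<xi>' \<in> \<Xi> \<Longrightarrow> norm (G x \<xi> - G x \<xi>') \<le> \<sigma>"
    and D: "D \<in> PiE {1..N} (\<lambda>_. \<Xi>)" and i: "i \<in> {1..N}" and \<xi>: "\<xi> \<in> \<Xi>"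
  shows "norm (dy_x \<gamma> A B (empirical_map G N D) z0 K - dy_x \<gamma> A B (empirical_map G N (D(i := \<xi>))) z0 K)
    \<le> replace_one_sensitivity \<gamma> A B G \<Xi> N z0 K"
proof -
  define s where "s i = (\<lambda>(D, \<xi>). norm (dy_x \<gamma> A B (empirical_map G N D) z0 K
    - dy_x \<gamma> A B (empirical_map G N (D(i := \<xi>))) z0 K))" for i
  have "s i (D, \<xi>) \<le> \<gamma> * (\<sigma> / N) * (\<Sum>k<K. (5 + \<gamma> * (1 / \<theta>)) ^ k)"
    if i: "i \<in> {1..N}" and D: "D \<in> PiE {1..N} (\<lambda>_. \<Xi>)" and \<xi>: "\<xi> \<in> \<Xi>" for i D \<xi>
  proof -
    let ?F = "empirical_map G N D" and ?F' = "empirical_map G N (D(i := \<xi>))"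
    have "s i (D, \<xi>) \<le> norm (dy_z \<gamma> A B ?F z0 K - dy_z \<gamma> A B ?F' z0 K)"
      unfolding s_def dy_x_def prod.case by (rule resolvent_nonexpansive[OF B \<gamma>])
    also have "\<dots> \<le> \<gamma> * (\<sigma> / N) * (\<Sum>k<K. (5 + \<gamma> * (1 / \<theta>)) ^ k)"
    proof (rule dy_z_perturbation[OF A B \<gamma>])
      show "norm (?F x - ?F y) \<le> 1 / \<theta> * norm (x - y)" for x y
      proof (rule empirical_map_lipschitz)
        show "norm (G x (D j) - G y (D j)) \<le> 1 / \<theta> * norm (x - y)" if "j \<in> {1..N}" for j x y
          using cocoercive_imp_lipschitz[OF coco \<theta>, of "D j" x y] PiE_mem[OF D that] by simp
      qed (use i in auto)
      show "norm (?F x - ?F' x) \<le> \<sigma> / N" for x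
        unfolding norm_empirical_map_replace_one[OF i]
        using D i \<xi> by (intro divide_right_mono osc) auto
    qed (use \<theta> in auto)
    finally show ?thesis .
  qed
  then have "bdd_above (s i ` (PiE {1..N} (\<lambda>_. \<Xi>) \<times> \<Xi>))"
    using i by (intro bdd_aboveI2) auto
  then have "s i (D, \<xi>) \<le> (SUP p \<in> PiE {1..N} (\<lambda>_. \<Xi>) \<times> \<Xi>. s i p)"
    by (rule cSUP_upper[rotated]) (use D \<xi> in auto)
  also have "\<dots> \<le> (MAX i\<in>{1..N}. SUP p \<in> PiE {1..N} (\<lambda>_. \<Xi>) \<times> \<Xi>. s i p)"
    using i by (intro Max_ge) auto
  finally show ?thesis by (simp add: s_def replace_one_sensitivity_def)
qed

lemma borel_measurable_sample_iterates:
  fixes A B :: "(real ^ 'n) operator" and G :: "real ^ 'n \<Rightarrow> 'b \<Rightarrow> real ^ 'n"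
  assumes A: "maximally_monotone A" and B: "maximally_monotone B" and \<gamma>: "0 < \<gamma>"
    and G: "\<And>x. G x \<in> borel_measurable P"
    and cont: "\<And>\<xi>. \<xi> \<in> space P \<Longrightarrow> continuous_on UNIV (\<lambda>x. G x \<xi>)"
  shows "(\<lambda>D. dy_z \<gamma> A B (empirical_map G N D) z0 t) \<in> borel_measurable (PiM {1..N} (\<lambda>_. P))"
proof (induction t)
  case 0
  show ?case by simp
next
  case (Suc t)
  have J: "resolvent \<gamma> A' \<in> borel_measurable borel" if "maximally_monotone A'" for A' :: "(real ^ 'n) operator"
    using continuous_on_lipschitz_bound[of "resolvent \<gamma> A'" 1] resolvent_nonexpansive[OF that \<gamma>]
    by (intro borel_measurable_continuous_onI) auto
  note [measurable] = J[OF A] J[OF B] Suc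
  have [measurable]: "(\<lambda>D. G (resolvent \<gamma> B (dy_z \<gamma> A B (empirical_map G N D) z0 t)) (D i))
      \<in> borel_measurable (PiM {1..N} (\<lambda>_. P))" if "i \<in> {1..N}" for i
    by (rule borel_measurable_caratheodory[OF _ measurable_component_singleton[OF that] G cont]) measurable
  show ?case unfolding dy_z.simps Let_def empirical_map_def[of G N _ "resolvent _ _ _"] by measurable
qed

text \<open>The oracle may be unbounded in \<open>x\<close>; after centring, the oscillation bound
  gives a bound uniform in \<open>x\<close>, which the concentration lemmas require of the sample
  error.\<close>

lemma norm_deviation_le_of_oscillation:
  fixes g :: "'a \<Rightarrow> 'b::{banach, second_countable_topology}"
  assumes M: "prob_space M" and g: "g \<in> borel_measurable M"
    and osc: "\<And>x y. x \<in> space M \<Longrightarrow> y \<in> space M \<Longrightarrow> norm (g x - g y) \<le> \<sigma>"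
  shows "integrable M g" and "\<And>x. x \<in> space M \<Longrightarrow> norm (g x - (\<integral>y. g y \<partial>M)) \<le> \<sigma>"
proof -
  interpret prob_space M by fact
  obtain x0 where x0: "x0 \<in> space M" using not_empty by blast
  show int: "integrable M g"
  proof (rule integrable_prob_bounded[OF M g])
    show "norm (g x) \<le> norm (g x0) + \<sigma>" if "x \<in> space M" for x
      using osc[OF that x0] norm_triangle_sub[of "g x" "g x0"] by simp
  qed
  show "norm (g x - (\<integral>y. g y \<partial>M)) \<le> \<sigma>" if "x \<in> space M" for x
    using norm_integral_diff_prob_le[OF M _ int, of "\<lambda>_. g x" \<sigma>] osc[OF that] by (simp add: prob_space)
qed

theorem theorem2:
  fixes A B :: "(real ^ 'n) operator"
    and C :: "real ^ 'n \<Rightarrow> real ^ 'n"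
    and G :: "real ^ 'n \<Rightarrow> real ^ 'd \<Rightarrow> real ^ 'n"
    and \<Xi> :: "(real ^ 'd) set"
    and P :: "(real ^ 'd) measure"
    and z0 :: "real ^ 'n"
    and N K :: nat
    and \<gamma> \<theta> \<sigma> \<delta> :: real
  assumes "N \<ge> 1"
    and "\<theta> > 0" and "\<sigma> > 0"
    and "0 < \<gamma>" and "\<gamma> < 2 * \<theta>"
    and "0 < \<delta>" and "\<delta> < 1"
    and "maximally_monotone A" and "maximally_monotone B"
    and "cocoercive \<theta> C"
    and "zer3 A B C \<noteq> {}"
    and "prob_space P" and "space P = \<Xi>" and "sets P = sets (restrict_space borel \<Xi>)"
    and "\<And>x. G x \<in> borel_measurable P"
    and "\<And>x. prob_space.expectation P (G x) = C x"
    and "\<And>x \<xi> \<xi>'. \<xi> \<in> \<Xi> \<Longrightarrow> \<xi>' \<in> \<Xi> \<Longrightarrow> norm (G x \<xi> - G x \<xi>') \<le> \<sigma>"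
    and "\<And>\<xi>. \<xi> \<in> \<Xi> \<Longrightarrow> cocoercive \<theta> (\<lambda>x. G x \<xi>)"
  shows
    "let \<eta> = replace_one_sensitivity \<gamma> A B G \<Xi> N z0 K;
         \<phi> = phi_bound \<eta> \<theta> \<sigma> N \<delta>;
         PN = PiM {1..N} (\<lambda>_. P);
         xh = (\<lambda>D. dy_x \<gamma> A B (empirical_map G N D) z0 K);
         zh = (\<lambda>D. dy_z \<gamma> A B (empirical_map G N D) z0 K);
         E = {D \<in> space PN. norm (sample_error G C N D (xh D)) \<le> \<phi>}
     in E \<in> sets PN \<and> measure PN E \<ge> 1 - \<delta> \<and>
        (\<forall>D\<in>E. dy_residual \<gamma> A B C (zh D)
               \<le> dy_residual \<gamma> A B (empirical_map G N D) (zh D) + \<gamma> * \<phi>)"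
proof -
  note N = assms(1) and \<theta> = assms(2) and \<sigma> = assms(3) and \<gamma> = assms(4) and \<delta> = assms(6,7)
    and A = assms(8) and B = assms(9) and C = assms(10) and P = assms(12) and sp = assms(13)
    and G = assms(15) and EG = assms(16) and osc = assms(17) and coco = assms(18)
  define PN where "PN = PiM {1..N} (\<lambda>_. P)"
  define \<eta> where "\<eta> = replace_one_sensitivity \<gamma> A B G \<Xi> N z0 K"
  define \<nu> where "\<nu> = nu_bound \<eta> \<theta> \<sigma> N"
  define zh where "zh D = dy_z \<gamma> A B (empirical_map G N D) z0 K" for D
  define xh where "xh D = dy_x \<gamma> A B (empirical_map G N D) z0 K" for D
  define f where "f D = sample_error G C N D (xh D)" for D
  have spN: "space PN = PiE {1..N} (\<lambda>_. \<Xi>)" by (simp add: PN_def space_PiM sp)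
  interpret P: prob_space P by fact
  interpret PN: prob_space PN unfolding PN_def by (rule prob_space_PiM[OF P])
  obtain \<xi>0 where \<xi>0: "\<xi>0 \<in> \<Xi>" using P.not_empty sp by blast

  have sens: "norm (xh D - xh (D(i := \<xi>))) \<le> \<eta>" if "i \<in> {1..N}" "D \<in> space PN" "\<xi> \<in> \<Xi>" for i D \<xi>
    unfolding xh_def \<eta>_def
    by (rule replace_one_sensitivity_ge[OF A B \<gamma> \<theta> coco osc]) (use that spN in auto)
  obtain D0 where D0: "D0 \<in> space PN" using PN.not_empty by blast
  have "0 \<le> \<eta>" using order_trans[OF norm_ge_zero sens[OF _ D0 \<xi>0, of 1]] N by simp
  then have \<nu>: "0 < \<nu>" using \<theta> \<sigma> N by (simp add: \<nu>_def nu_bound_def add_nonneg_pos)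
  have GL: "norm (G x \<xi> - G y \<xi>) \<le> 1 / \<theta> * norm (x - y)" if "\<xi> \<in> \<Xi>" for x y \<xi>
    using cocoercive_imp_lipschitz[OF coco[OF that] \<theta>] by simp
  have CL: "norm (C x - C y) \<le> 1 / \<theta> * norm (x - y)" for x y
    using cocoercive_imp_lipschitz[OF C \<theta>] by simp
  have empL: "norm (empirical_map G N D x - empirical_map G N D y) \<le> 1 / \<theta> * norm (x - y)"
    if "D \<in> space PN" for D x y
    using that spN by (intro empirical_map_lipschitz N GL) auto

  \<comment> \<open>The contribution of sample \<open>i\<close> to the error. It depends on all
    samples through the iterate, yet is bounded by \<sigma> wherever the iterate lies.\<close>
  define q where "q i D = G (xh D) (D i) - C (xh D)" for i D
  have f_q: "f D = (1 / real N) *\<^sub>R (\<Sum>i=1..N. q i D)" for D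
    using N unfolding f_def sample_error_def empirical_map_def q_def sum_subtractf scaleR_diff_right
    by (simp add: sum_constant_scaleR del: sum_constant)
  have Gmean: "integrable P (G x)" "\<xi> \<in> \<Xi> \<Longrightarrow> norm (G x \<xi> - C x) \<le> \<sigma>" for x \<xi>
    using norm_deviation_le_of_oscillation[OF P G[of x], of \<sigma>] osc sp EG[of x] by auto
  have q_bound: "norm (q i D) \<le> \<sigma>" if "i \<in> {1..N}" "D \<in> space PN" for i D
    unfolding q_def by (rule Gmean(2)) (use that spN in auto)
  have contG: "continuous_on UNIV (\<lambda>x. G x \<xi>)" if "\<xi> \<in> space P" for \<xi>
    by (rule continuous_on_lipschitz_bound[OF GL]) (use that sp in auto)
  have xh_meas[measurable]: "xh \<in> borel_measurable PN"
  proof -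
    have "resolvent \<gamma> B \<in> borel_measurable borel"
      using continuous_on_lipschitz_bound[of "resolvent \<gamma> B" 1] resolvent_nonexpansive[OF B \<gamma>]
      by (intro borel_measurable_continuous_onI) auto
    with borel_measurable_sample_iterates[OF A B \<gamma> G contG] show ?thesis
      unfolding xh_def dy_x_def PN_def by (rule measurable_compose)
  qed
  have [measurable]: "C \<in> borel_measurable borel"
    by (intro borel_measurable_continuous_onI continuous_on_lipschitz_bound[OF CL])
  have q_meas[measurable]: "q i \<in> borel_measurable PN" if i: "i \<in> {1..N}" for i
  proof -
    have [measurable]: "(\<lambda>D. G (xh D) (D i)) \<in> borel_measurable PN"
      by (rule borel_measurable_caratheodory[OF xh_meas _ G contG])
         (unfold PN_def, rule measurable_component_singleton[OF i])
    show ?thesis unfolding q_def by measurable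
  qed
  have f_meas[measurable]: "f \<in> borel_measurable PN" unfolding f_q by measurable
  have f_bound: "norm (f D) \<le> \<sigma>" if "D \<in> space PN" for D
  proof -
    have "norm (\<Sum>i=1..N. q i D) \<le> (\<Sum>i=1..N. \<sigma>)" by (rule sum_norm_le) (rule q_bound[OF _ that])
    then show ?thesis using N by (simp add: f_q divide_le_eq mult_ac)
  qed

  have f_diff: "norm (f D - f (D(i := \<xi>))) \<le> \<nu>"
    if i: "i \<in> {1..N}" and D: "D \<in> space PN" and \<xi>: "\<xi> \<in> \<Xi>" for i D \<xi>
  proof -
    let ?D = "D(i := \<xi>)"
    \<comment> \<open>The swap is split into moving the iterate in the empirical map
      (\<open>?a\<close>), exchanging the sample at a fixed point (\<open>?b\<close>) and moving the
      iterate in \<open>C\<close> (\<open>?c\<close>). \<open>?a\<close> and \<open>?c\<close> make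
      up the factor 2 in \<nu>.\<close>
    let ?a = "empirical_map G N D (xh D) - empirical_map G N D (xh ?D)"
    let ?b = "empirical_map G N D (xh ?D) - empirical_map G N ?D (xh ?D)"
    let ?c = "C (xh D) - C (xh ?D)"
    have s: "1 / \<theta> * norm (xh D - xh ?D) \<le> \<eta> / \<theta>"
      using sens[OF i D \<xi>] \<theta> by (simp add: divide_right_mono)
    have "norm ?a \<le> \<eta> / \<theta>" "norm ?c \<le> \<eta> / \<theta>"
      using order_trans[OF empL[OF D] s] order_trans[OF CL s] by blast+
    moreover have "norm ?b \<le> \<sigma> / N"
      unfolding norm_empirical_map_replace_one[OF i]
      using D i \<xi> spN by (intro divide_right_mono osc) auto
    moreover have "norm (?a + ?b - ?c) \<le> norm ?a + norm ?b + norm ?c"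
      using norm_triangle_ineq4[of "?a + ?b" ?c] norm_triangle_ineq[of ?a ?b] by linarith
    moreover have "f D - f ?D = ?a + ?b - ?c" by (simp add: f_def sample_error_def)
    ultimately show ?thesis by (simp add: \<nu>_def nu_bound_def)
  qed

  text \<open>Freezing the iterate at a fixed sample value makes the \<open>i\<close>-th term centred in the \<open>i\<close>-th
    sample, at the price of moving the iterate by at most \<open>\<eta>\<close>.\<close>
  have q_mean: "norm (\<integral>D. q i D \<partial>PN) \<le> 2 * \<eta> / \<theta>" if i: "i \<in> {1..N}" for i
  proof -
    let ?J = "{1..N} - {i}"
    have J: "insert i ?J = {1..N}" using i by auto
    interpret S: product_sigma_finite "\<lambda>_::nat. P"
      by (intro product_sigma_finite.intro P.sigma_finite_measure_axioms)
    have upd: "D(i := \<xi>) \<in> space PN" if "D \<in> space (PiM ?J (\<lambda>_. P))" "\<xi> \<in> \<Xi>" for D \<xi>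
      using fun_upd_in_space_PiM[OF that(1), of \<xi> i] that(2) sp J by (simp add: PN_def)
    have sec: "(\<lambda>\<xi>. q i (D(i := \<xi>))) \<in> borel_measurable P" if "D \<in> space (PiM ?J (\<lambda>_. P))" for D
      using measurable_compose[OF measurable_component_update[OF that, of i], of "q i"] q_meas[OF i] J
      by (simp add: PN_def)
    have inner: "norm (\<integral>\<xi>. q i (D(i := \<xi>)) \<partial>P) \<le> 2 * \<eta> / \<theta>" if D: "D \<in> space (PiM ?J (\<lambda>_. P))" for D
    proof -
      define x where "x = xh (D(i := \<xi>0))"
      have "norm ((\<integral>\<xi>. q i (D(i := \<xi>)) \<partial>P) - (\<integral>\<xi>. G x \<xi> - C x \<partial>P)) \<le> 2 * \<eta> / \<theta>"
      proof (rule norm_integral_diff_prob_le[OF P])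
        show "integrable P (\<lambda>\<xi>. q i (D(i := \<xi>)))"
          by (rule integrable_prob_bounded[OF P sec[OF D], of \<sigma>]) (use upd[OF D] sp i q_bound in auto)
        show "integrable P (\<lambda>\<xi>. G x \<xi> - C x)" using Gmean(1) by simp
        fix \<xi> assume "\<xi> \<in> space P"
        then have \<xi>: "\<xi> \<in> \<Xi>" using sp by simp
        let ?y = "xh (D(i := \<xi>))"
        \<comment> \<open>The sensitivity applies with \<open>D(i := \<xi>)\<close> as dataset and
          \<open>\<xi>0\<close> as replacement: the second update overwrites the first.\<close>
        have "1 / \<theta> * norm (?y - x) \<le> \<eta> / \<theta>"
          using sens[OF i upd[OF D \<xi>] \<xi>0] \<theta> by (simp add: divide_right_mono x_def)
        with GL[OF \<xi>, of ?y x] CL[of ?y x]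
        have "norm (G ?y \<xi> - G x \<xi>) + norm (C ?y - C x) \<le> 2 * \<eta> / \<theta>" by simp
        moreover have eq: "q i (D(i := \<xi>)) - (G x \<xi> - C x) = (G ?y \<xi> - G x \<xi>) - (C ?y - C x)"
          by (simp add: q_def)
        ultimately show "norm (q i (D(i := \<xi>)) - (G x \<xi> - C x)) \<le> 2 * \<eta> / \<theta>"
          unfolding eq using norm_triangle_ineq4[of "G ?y \<xi> - G x \<xi>" "C ?y - C x"] by linarith
      qed
      \<comment> \<open>With \<open>x\<close> independent of \<xi>, unbiasedness makes the
        subtracted integral zero.\<close>
      then show ?thesis using Gmean(1) EG by (simp add: P.prob_space)
    qed
    have int: "integrable PN (q i)"
      by (rule integrable_prob_bounded[OF PN.prob_space_axioms q_meas[OF i] q_bound[OF i]])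
    have "(\<integral>D. q i D \<partial>PN) = (\<integral>D. \<integral>\<xi>. q i (D(i := \<xi>)) \<partial>P \<partial>PiM ?J (\<lambda>_. P))"
      using S.product_integral_insert[of ?J i "q i"] int J by (simp add: PN_def)
    also have "norm \<dots> \<le> 2 * \<eta> / \<theta>"
      using borel_measurable_marginal[of "\<lambda>_. P" i "q i" ?J] q_meas[OF i] J P.sigma_finite_measure_axioms
      by (intro norm_integral_prob_le prob_space_PiM P inner) (auto simp: PN_def)
    finally show ?thesis .
  qed
  have f_mean: "norm (\<integral>D. f D \<partial>PN) \<le> 2 * \<eta> / \<theta>"
  proof -
    have "integrable PN (q i)" if "i \<in> {1..N}" for i
      by (rule integrable_prob_bounded[OF PN.prob_space_axioms q_meas[OF that] q_bound[OF that]])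
    then have "(\<integral>D. f D \<partial>PN) = (1 / real N) *\<^sub>R (\<Sum>i=1..N. \<integral>D. q i D \<partial>PN)"
      by (simp add: f_q)
    moreover have "norm (\<Sum>i=1..N. \<integral>D. q i D \<partial>PN) \<le> (\<Sum>i=1..N. 2 * \<eta> / \<theta>)"
      by (rule sum_norm_le) (rule q_mean)
    ultimately show ?thesis using N by (simp add: divide_le_eq mult_ac)
  qed

  define \<phi> where "\<phi> = phi_bound \<eta> \<theta> \<sigma> N \<delta>"
  define E where "E = {D \<in> space PN. norm (f D) \<le> \<phi>}"
  have E_sets: "E \<in> sets PN" unfolding E_def by measurable
  have "1 - \<delta> \<le> PN.prob {D\<in>space PN. norm (f D) \<le>
      norm (\<integral>D. f D \<partial>PN) + \<nu> * sqrt (2 * real (card {1..N}) * ln (2 / \<delta>))}"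
    unfolding PN_def
  proof (rule vector_McDiarmid[where b = \<sigma>])
    show "f \<in> borel_measurable (PiM {1..N} (\<lambda>_. P))" using f_meas by (simp add: PN_def)
    show "norm (f D) \<le> \<sigma>" if "D \<in> space (PiM {1..N} (\<lambda>_. P))" for D
      using f_bound that by (simp add: PN_def)
    show "norm (f D - f (D(i := \<xi>))) \<le> \<nu>"
      if "i \<in> {1..N}" "D \<in> space (PiM {1..N} (\<lambda>_. P))" "\<xi> \<in> space P" for i D \<xi>
      using f_diff[of i D \<xi>] that by (simp add: PN_def sp)
  qed (use P N \<nu> \<delta> in auto)
  also have "\<dots> \<le> PN.prob E"
    using f_mean E_sets by (intro PN.finite_measure_mono) (auto simp: E_def \<phi>_def phi_bound_def \<nu>_def)
  finally have prob: "1 - \<delta> \<le> PN.prob E" .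
  have res: "dy_residual \<gamma> A B C (zh D) \<le> dy_residual \<gamma> A B (empirical_map G N D) (zh D) + \<gamma> * \<phi>"
    if "D \<in> E" for D
  proof -
    let ?F = "empirical_map G N D"
    \<comment> \<open>At \<open>zh D\<close> the forward maps are evaluated at \<open>xh D\<close>,
      so their difference is exactly the sample error \<open>f D\<close>.\<close>
    have "norm (dy_operator \<gamma> A B ?F (zh D) - dy_operator \<gamma> A B C (zh D)) \<le> \<gamma> * norm (f D)"
      using dy_operator_perturbation[OF A \<gamma>, of B ?F "zh D" C]
      by (simp add: f_def sample_error_def xh_def zh_def dy_x_def)
    also have "\<dots> \<le> \<gamma> * \<phi>" using that \<gamma> by (simp add: E_def)
    finally show ?thesis
      using norm_triangle_ineq[of "zh D - dy_operator \<gamma> A B ?F (zh D)"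
          "dy_operator \<gamma> A B ?F (zh D) - dy_operator \<gamma> A B C (zh D)"]
      by (simp add: dy_residual_def)
  qed
  show ?thesis
    using E_sets prob res
    unfolding Let_def E_def PN_def f_def xh_def zh_def \<phi>_def \<eta>_def by blast
qed

end
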